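(* (a) Let $f \in \mathcal C(\{0,1\}^{\mathbb N})$ and $\epsilon > 0$. There exist positive integers $K$, $S$ and $M$ so that if $k \geq K$, $s \geq S$ and $m$ is a positive integer multiple of $M$, then there are $g \in \mathcal C(\{0,1\}^{\mathbb N})$ and a partition $\mathcal P$ of $\{0,1\}^{\mathbb N}$ with $$\tilde d(f,g) < \epsilon \quad\text{and}\quad \operatorname{mesh}(\mathcal P) < \epsilon,$$ such that the digraph $\operatorname{Gr}(g,\mathcal P)$ consists of exactly $k$ disjoint balloons of type $(s,m)$. (b) Let $f \in \mathcal H(\{0,1\}^{\mathbb N})$ and $\epsilon > 0$. There exist positive integers $K$, $N$, $S$ and $M$ so that if $k \geq K$, $s \geq S$ and $n, m$ are positive integer multiples of $N, M$, respectively, then there are $g \in \mathcal H(\{0,1\}^{\mathbb N})$ and a partition $\mathcal P$ of $\{0,1\}^{\mathbb N}$ with $$\tilde d(f,g) < \epsilon \quad\text{and}\quad \operatorname{mesh}(\mathcal P) < \epsilon,$$ such that the digraph $\operatorname{Gr}(g,\mathcal P)$ consists of exactly $k$ disjoint dumbbells of type $(n,s,m)$.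
   Context: $\{0,1\}^{\mathbb N}$ ($\mathbb N$ the positive integers) has the product topology and the metric $d(\sigma,\tau)=1/n$, where $n$ is the least positive integer with $\sigma(n)\neq\tau(n)$, and $d(\sigma,\sigma)=0$. $\mathcal C(\{0,1\}^{\mathbb N})$ (resp. $\mathcal H(\{0,1\}^{\mathbb N})$) is the space of all continuous self-maps (resp. all homeomorphisms onto itself) of $\{0,1\}^{\mathbb N}$, with the metric $\tilde d(f,g)=\max_\sigma d(f(\sigma),g(\sigma))$. A partition of $\{0,1\}^{\mathbb N}$ is a finite collection of nonempty pairwise disjoint clopen sets whose union is $\{0,1\}^{\mathbb N}$; its mesh is the maximum of the diameters of its members. A digraph consists of a finite set of vertices and a set of directed edges between vertices (an edge from a vertex to itself is allowed). For a partition $\mathcal P$, $\operatorname{Gr}(g,\mathcal P)$ is the digraph with vertex set $\mathcal P$ in which $\overrightarrow{ab}$ is an edge if and only if $g(a)\cap b\neq\emptyset$. A balloon of type $(s,t)$ ($s,t\ge1$) is a digraph whose vertex set is the union of two disjoint sets $\{v_1,\dots,v_s\}$ and $\{w_1,\dots,w_t\}$ (of $s$ and $t$ distinct vertices), and whose edges are exactly $\overrightarrow{v_iv_{i+1}}$ ($1\le i<s$), $\overrightarrow{w_jw_{j+1}}$ ($1\le j<t$), $\overrightarrow{w_tw_1}$ and $\overrightarrow{v_sw_1}$. A dumbbell of type $(r,s,t)$ ($r,s,t\ge 1$) is a digraph whose vertex set is the union of three disjoint sets $\{u_1,\dots,u_r\}$, $\{v_1,\dots,v_s\}$, $\{w_1,\dots,w_t\}$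 (of $r,s,t$ distinct vertices), and whose edges are exactly: $\overrightarrow{u_iu_{i+1}}$ ($1\le i<r$) and $\overrightarrow{u_ru_1}$; $\overrightarrow{w_iw_{i+1}}$ ($1\le i<t$) and $\overrightarrow{w_tw_1}$; $\overrightarrow{v_iv_{i+1}}$ ($1\le i<s$); and $\overrightarrow{u_1v_1}$, $\overrightarrow{v_sw_1}$. A digraph consists of exactly $k$ disjoint balloons (dumbbells) of a given type if it is the disjoint union (with no edges between the pieces) of exactly $k$ such digraphs. *)

theory Defs
  imports "HOL-Analysis.Analysis" "Graph_Theory.Pair_Digraph"
begin

text \<open>
  Points of the Cantor space are functions on \<^typ>\<open>nat\<close>, so the coordinate that is numbered
  \<open>n \<ge> 1\<close> in the text is \<open>\<sigma> (n - 1)\<close> here; this accounts for the \<^const>\<open>Suc\<close> in the metric.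
  The topology is the library's product topology on function types, with \<^typ>\<open>bool\<close> discrete.
\<close>

type_synonym cantor = "nat \<Rightarrow> bool"

definition cantor_dist :: "cantor \<Rightarrow> cantor \<Rightarrow> real" where
  "cantor_dist \<sigma> \<tau> = (if \<sigma> = \<tau> then 0 else 1 / real (Suc (LEAST n. \<sigma> n \<noteq> \<tau> n)))"

lemma cantor_dist_less_iff:
  "cantor_dist \<sigma> \<tau> < 1 / real (Suc N) \<longleftrightarrow> (\<forall>n\<le>N. \<sigma> n = \<tau> n)"
proof (cases "\<sigma> = \<tau>")
  case True
  then show ?thesis by (simp add: cantor_dist_def)
next
  case False
  define l where "l = (LEAST n. \<sigma> n \<noteq> \<tau> n)"
  from False obtain i where "\<sigma> i \<noteq> \<tau> i" by blast
  then have l: "\<sigma> l \<noteq> \<tau> l" unfolding l_def by (rule LeastI)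
  have least: "\<sigma> n = \<tau> n" if "n < l" for n
    using not_less_Least that unfolding l_def by blast
  have "cantor_dist \<sigma> \<tau> < 1 / real (Suc N) \<longleftrightarrow> N < l"
    using False by (simp add: cantor_dist_def l_def divide_simps)
  also have "\<dots> \<longleftrightarrow> (\<forall>n\<le>N. \<sigma> n = \<tau> n)"
    using l least by (meson le_less_trans not_le)
  finally show ?thesis .
qed

interpretation cantor: Metric_space UNIV cantor_dist
proof
  fix x y z :: cantor
  show "0 \<le> cantor_dist x y" by (simp add: cantor_dist_def)
  show "cantor_dist x y = cantor_dist y x" by (simp add: cantor_dist_def eq_commute)
  show "cantor_dist x y = 0 \<longleftrightarrow> x = y" by (simp add: cantor_dist_def)
  show "cantor_dist x z \<le> cantor_dist x y + cantor_dist y z"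
  proof (cases "x = z")
    case True
    then show ?thesis by (simp add: cantor_dist_def)
  next
    case False
    define l where "l = (LEAST n. x n \<noteq> z n)"
    have eq: "cantor_dist x z = 1 / real (Suc l)"
      using False by (simp add: cantor_dist_def l_def)
    have "\<not> (\<forall>n\<le>l. x n = z n)" using cantor_dist_less_iff[of x z l] eq by simp
    then have "\<not> (\<forall>n\<le>l. x n = y n) \<or> \<not> (\<forall>n\<le>l. y n = z n)" by force
    then have "1 / real (Suc l) \<le> cantor_dist x y \<or> 1 / real (Suc l) \<le> cantor_dist y z"
      by (metis cantor_dist_less_iff not_le)
    moreover have "0 \<le> cantor_dist x y" "0 \<le> cantor_dist y z"
      by (simp_all add: cantor_dist_def)
    ultimately show ?thesis unfolding eq by linarith
  qed
qed

lemma cantor_mtopology: "cantor.mtopology = euclidean"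
  unfolding topology_eq
proof
  fix U :: "cantor set"
  have open_ball: "open {y. \<forall>n\<le>N. x n = y n}" for x :: cantor and N
  proof -
    have "{y. \<forall>n\<le>N. x n = y n} = (\<Inter>n\<in>{..N}. (\<lambda>y. y n) -` {x n})" by auto
    moreover have "open ((\<lambda>y::cantor. y n) -` {x n})" for n
      by (intro open_vimage open_discrete continuous_on_product_coordinates)
    ultimately show ?thesis by auto
  qed
  have mball: "cantor.mball x (1 / real (Suc N)) = {y. \<forall>n\<le>N. x n = y n}" for x N
    unfolding cantor.mball_def cantor_dist_less_iff by simp
  have "openin cantor.mtopology U \<longleftrightarrow> (\<forall>x\<in>U. \<exists>N. {y. \<forall>n\<le>N. x n = y n} \<subseteq> U)"
    unfolding cantor.openin_mtopology
  proof (intro iffI conjI ballI allI impI)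
    fix x
    assume "U \<subseteq> UNIV \<and> (\<forall>x. x \<in> U \<longrightarrow> (\<exists>r>0. cantor.mball x r \<subseteq> U))" "x \<in> U"
    then obtain r where "r > 0" "cantor.mball x r \<subseteq> U" by blast
    moreover obtain N where "1 / real (Suc N) < r"
      using nat_approx_posE[OF \<open>r > 0\<close>] by blast
    ultimately have "{y. \<forall>n\<le>N. x n = y n} \<subseteq> U"
      unfolding mball[symmetric] using cantor.mball_subset_concentric[of "1 / real (Suc N)" r x] by (meson less_imp_le subset_trans)
    then show "\<exists>N. {y. \<forall>n\<le>N. x n = y n} \<subseteq> U" by blast
  next
    fix x
    assume "\<forall>x\<in>U. \<exists>N. {y. \<forall>n\<le>N. x n = y n} \<subseteq> U" "x \<in> U"
    then obtain N where "{y. \<forall>n\<le>N. x n = y n} \<subseteq> U" by blast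
    then have "cantor.mball x (1 / real (Suc N)) \<subseteq> U"
      unfolding mball .
    then show "\<exists>r>0. cantor.mball x r \<subseteq> U"
      by (intro exI[of _ "1 / real (Suc N)"]) simp
  qed simp
  also have "\<dots> \<longleftrightarrow> open U"
  proof
    assume *: "\<forall>x\<in>U. \<exists>N. {y. \<forall>n\<le>N. x n = y n} \<subseteq> U"
    show "open U"
    proof (rule Topological_Spaces.openI)
      fix x assume "x \<in> U"
      with * obtain N where "{y. \<forall>n\<le>N. x n = y n} \<subseteq> U" by blast
      then show "\<exists>T. open T \<and> x \<in> T \<and> T \<subseteq> U"
        using open_ball[of N x] by (intro exI[of _ "{y. \<forall>n\<le>N. x n = y n}"]) simp
    qed
  next
    assume "open U"
    show "\<forall>x\<in>U. \<exists>N. {y. \<forall>n\<le>N. x n = y n} \<subseteq> U"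
    proof
      fix x assume "x \<in> U"
      then obtain X where X: "x \<in> Pi\<^sub>E UNIV X" "finite {i. X i \<noteq> UNIV}" "Pi\<^sub>E UNIV X \<subseteq> U"
        using product_topology_open_contains_basis[of "\<lambda>_. euclidean" UNIV U x] \<open>open U\<close>
        by (auto simp: open_fun_def)
      obtain N where N: "\<forall>i\<in>{i. X i \<noteq> UNIV}. i \<le> N"
        using X(2) finite_nat_set_iff_bounded_le by blast
      have "{y. \<forall>n\<le>N. x n = y n} \<subseteq> Pi\<^sub>E UNIV X"
      proof
        fix y assume y: "y \<in> {y. \<forall>n\<le>N. x n = y n}"
        have "y i \<in> X i" for i
        proof (cases "i \<le> N")
          case True
          then have "x i = y i" using y by simp
          moreover have "x i \<in> X i" using X(1) by (simp add: PiE_iff)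
          ultimately show ?thesis by (simp only:)
        next
          case False
          then show ?thesis using N by auto
        qed
        then show "y \<in> Pi\<^sub>E UNIV X" by auto
      qed
      then show "\<exists>N. {y. \<forall>n\<le>N. x n = y n} \<subseteq> U" using X(3) by (meson subset_trans)
    qed
  qed
  finally show "openin cantor.mtopology U \<longleftrightarrow> openin euclidean U" by simp
qed

definition cantor_maps :: "(cantor \<Rightarrow> cantor) set" where
  "cantor_maps = {f. continuous_on UNIV f}"

definition cantor_homeos :: "(cantor \<Rightarrow> cantor) set" where
  "cantor_homeos = {f. \<exists>f'. homeomorphism UNIV UNIV f f'}"

text \<open>
  All distances lie in \<open>{0} \<union> {1 / n | n \<ge> 1}\<close>, and every nonempty subset of this set has a
  greatest element, so the suprema in the next two definitions are maxima.
\<close>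

definition unif_dist :: "(cantor \<Rightarrow> cantor) \<Rightarrow> (cantor \<Rightarrow> cantor) \<Rightarrow> real" where
  "unif_dist f g = (SUP \<sigma>. cantor_dist (f \<sigma>) (g \<sigma>))"

definition cantor_diam :: "cantor set \<Rightarrow> real" where
  "cantor_diam A = (SUP (\<sigma>, \<tau>)\<in>A \<times> A. cantor_dist \<sigma> \<tau>)"

definition clopen_partition :: "cantor set set \<Rightarrow> bool" where
  "clopen_partition P \<longleftrightarrow> finite P \<and> partition_on UNIV P \<and> (\<forall>A\<in>P. open A \<and> closed A)"

definition mesh :: "cantor set set \<Rightarrow> real" where
  "mesh P = Max (cantor_diam ` P)"

definition Gr :: "(cantor \<Rightarrow> cantor) \<Rightarrow> cantor set set \<Rightarrow> cantor set pair_pre_digraph" where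
  "Gr g P = \<lparr>pverts = P, parcs = {(a, b). a \<in> P \<and> b \<in> P \<and> g ` a \<inter> b \<noteq> {}}\<rparr>"

definition balloon :: "nat \<Rightarrow> nat \<Rightarrow> 'a pair_pre_digraph \<Rightarrow> bool" where
  "balloon s t G \<longleftrightarrow> 1 \<le> s \<and> 1 \<le> t \<and>
    (\<exists>v w :: nat \<Rightarrow> 'a.
      inj_on v {1..s} \<and> inj_on w {1..t} \<and> v ` {1..s} \<inter> w ` {1..t} = {} \<and>
      pverts G = v ` {1..s} \<union> w ` {1..t} \<and>
      parcs G = {(v i, v (i + 1)) | i. 1 \<le> i \<and> i < s}
              \<union> {(w j, w (j + 1)) | j. 1 \<le> j \<and> j < t}
              \<union> {(w t, w 1), (v s, w 1)})"

definition dumbbell :: "nat \<Rightarrow> nat \<Rightarrow> nat \<Rightarrow> 'a pair_pre_digraph \<Rightarrow> bool" where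
  "dumbbell r s t G \<longleftrightarrow> 1 \<le> r \<and> 1 \<le> s \<and> 1 \<le> t \<and>
    (\<exists>u v w :: nat \<Rightarrow> 'a.
      inj_on u {1..r} \<and> inj_on v {1..s} \<and> inj_on w {1..t} \<and>
      u ` {1..r} \<inter> v ` {1..s} = {} \<and> u ` {1..r} \<inter> w ` {1..t} = {} \<and>
      v ` {1..s} \<inter> w ` {1..t} = {} \<and>
      pverts G = u ` {1..r} \<union> v ` {1..s} \<union> w ` {1..t} \<and>
      parcs G = {(u i, u (i + 1)) | i. 1 \<le> i \<and> i < r} \<union> {(u r, u 1)}
              \<union> {(w i, w (i + 1)) | i. 1 \<le> i \<and> i < t} \<union> {(w t, w 1)}
              \<union> {(v i, v (i + 1)) | i. 1 \<le> i \<and> i < s}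
              \<union> {(u 1, v 1), (v s, w 1)})"

definition consists_of_disjoint ::
    "nat \<Rightarrow> ('a pair_pre_digraph \<Rightarrow> bool) \<Rightarrow> 'a pair_pre_digraph \<Rightarrow> bool" where
  "consists_of_disjoint k Q G \<longleftrightarrow>
    (\<exists>H :: nat \<Rightarrow> 'a pair_pre_digraph.
      (\<forall>i<k. Q (H i)) \<and> disjoint_family_on (\<lambda>i. pverts (H i)) {..<k} \<and>
      pverts G = (\<Union>i<k. pverts (H i)) \<and> parcs G = (\<Union>i<k. parcs (H i)))"

end

theory Submission
  imports Defs "HOL-Library.Omega_Words_Fun"
begin

text \<open>
  By uniform continuity there is a depth \<open>D\<close> such that the first \<open>D\<close> coordinates of a point \<open>x\<close>
  determine \<open>f x\<close> up to an error below \<open>\<epsilon>\<close>. Record which words of length \<open>D\<close> can follow each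
  other: \<open>(a, b)\<close> is a transition if \<open>f\<close> maps some point of the cylinder of \<open>a\<close> into the cylinder
  of \<open>b\<close>. Every map that moves points only along transitions is \<open>\<epsilon>\<close>-close to \<open>f\<close>
  (\<open>approximate_by_copies\<close>). So it suffices to label the vertices of \<open>k\<close> balloons or dumbbells
  by words of length \<open>D\<close>, so that edges go to transitions and every word is used, and then
  to realise this labelled digraph by a map.

  The labelling comes from walks. Each word has a successor, and if \<open>f\<close> is onto it also has a
  predecessor. Iterating a choice of successors on the finite set \<open>A\<close> of words becomes
  periodic after at most \<open>card A\<close> steps, with a period that divides \<open>fact (card A)\<close>. Hence, if
  the tail is long and the loop has a length divisible by \<open>fact (card A)\<close>, the walk that starts
  at a given word wraps around a balloon; continuing it backwards through predecessors, one gets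
  a walk that wraps around a dumbbell (\<open>balloon_walk\<close>, \<open>dumbbell_walk\<close>). One component per word
  covers all the words, and further components may repeat labels.

  For the realisation, a cylinder can be cut into any positive number of smaller cylinders, and
  any two cylinders are homeomorphic by exchanging their prefixes. Cut the cylinder of each word
  into one piece per vertex with this label, cut each piece into one cylinder per outgoing
  edge, and also into one cylinder per incoming edge. Sending the source cylinder of
  each edge to its target cylinder gives a homeomorphism with exactly the prescribed digraph; if
  some vertices have no incoming edge, the same recipe still gives a continuous map
  (\<open>realise_digraph\<close>).
\<close>

section \<open>Cylinders and complete prefix codes\<close>

definition cyl :: "bool list \<Rightarrow> cantor set" where
  "cyl w = {x. \<forall>n<length w. x n = w ! n}"

lemma cyl_Nil [simp]: "cyl [] = UNIV"
  by (simp add: cyl_def)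

lemma cyl_append: "x \<in> cyl (u @ v) \<longleftrightarrow> x \<in> cyl u \<and> suffix (length u) x \<in> cyl v"
proof
  assume *: "x \<in> cyl (u @ v)"
  have "x n = u ! n" if "n < length u" for n
    using * that by (auto simp: cyl_def nth_append dest: spec[of _ n])
  moreover have "x (length u + n) = v ! n" if "n < length v" for n
    using * that by (auto simp: cyl_def nth_append dest: spec[of _ "length u + n"])
  ultimately show "x \<in> cyl u \<and> suffix (length u) x \<in> cyl v"
    by (auto simp: cyl_def suffix_def)
next
  assume *: "x \<in> cyl u \<and> suffix (length u) x \<in> cyl v"
  have "x n = (u @ v) ! n" if "n < length (u @ v)" for n
  proof (cases "n < length u")
    case True
    then show ?thesis using * by (simp add: cyl_def nth_append)
  next
    case False
    then have "n - length u < length v" using that by auto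
    then have "suffix (length u) x (n - length u) = v ! (n - length u)"
      using * by (simp add: cyl_def)
    then show ?thesis using False by (simp add: suffix_def nth_append)
  qed
  then show "x \<in> cyl (u @ v)" by (simp add: cyl_def)
qed

lemma conc_mem_cyl: "w \<frown> x \<in> cyl w"
  by (simp add: cyl_def)

lemma cyl_nonempty: "cyl w \<noteq> {}"
  using conc_mem_cyl by blast

lemma suffix_conc_same: "suffix (length w) (w \<frown> x) = x"
  by (simp add: suffix_def conc_def)

lemma conc_suffix_same: "x \<in> cyl w \<Longrightarrow> w \<frown> suffix (length w) x = x"
  by (auto simp: suffix_def conc_def cyl_def)

lemma open_coordinate: "open {x :: cantor. x n = c}"
proof -
  have "open ((\<lambda>y :: cantor. y n) -` {c})"
    by (intro open_vimage open_discrete continuous_on_product_coordinates)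
  then show ?thesis by (simp add: vimage_def)
qed

lemma open_cyl: "open (cyl w)"
proof -
  have "cyl w = (\<Inter>n\<in>{..<length w}. {x. x n = w ! n})" by (auto simp: cyl_def)
  then show ?thesis by (auto intro: open_coordinate)
qed

lemma closed_cyl: "closed (cyl w)"
proof -
  have "- cyl w = (\<Union>n\<in>{..<length w}. {x. x n = (\<not> w ! n)})" by (auto simp: cyl_def)
  moreover have "open \<dots>" by (intro open_UN ballI open_coordinate)
  ultimately show ?thesis by (simp add: closed_def)
qed

definition complete_code :: "'i set \<Rightarrow> ('i \<Rightarrow> bool list) \<Rightarrow> bool" where
  "complete_code I W \<longleftrightarrow> (\<forall>x. \<exists>!i. i \<in> I \<and> x \<in> cyl (W i))"

lemma complete_codeE:
  assumes "complete_code I W"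
  obtains i where "i \<in> I" "x \<in> cyl (W i)"
  using assms unfolding complete_code_def by blast

lemma complete_code_unique:
  assumes "complete_code I W" "i \<in> I" "j \<in> I" "x \<in> cyl (W i)" "x \<in> cyl (W j)"
  shows "i = j"
  using assms unfolding complete_code_def by blast

lemma complete_code_words: "complete_code {w. length w = n} (\<lambda>w. w)"
  unfolding complete_code_def
proof
  fix x :: cantor
  have "w = map x [0..<n]" if "length w = n" "x \<in> cyl w" for w
    using that by (auto intro!: nth_equalityI simp: cyl_def)
  then show "\<exists>!w. w \<in> {w. length w = n} \<and> x \<in> cyl w"
    by (intro ex1I[of _ "map x [0..<n]"]) (auto simp: cyl_def)
qed

text \<open>
  Such a code is a comb: the words \<open>0, 10, 110, \<dots>\<close>, closed off by a word that consists of
  ones only.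
\<close>

lemma complete_code_exists:
  assumes "finite I" "I \<noteq> {}"
  shows "\<exists>W. complete_code I W"
  using assms
proof (induction I rule: finite_ne_induct)
  case (singleton i)
  show ?case by (rule exI[of _ "\<lambda>_. []"]) (simp add: complete_code_def)
next
  case (insert i I)
  then obtain W where W: "complete_code I W" by blast
  define W' where "W' = (\<lambda>j. if j = i then [False] else True # W j)"
  have new: "x \<in> cyl (W' i) \<longleftrightarrow> \<not> x 0" for x
    by (simp add: W'_def cyl_def)
  have old: "x \<in> cyl (W' j) \<longleftrightarrow> x 0 \<and> suffix 1 x \<in> cyl (W j)" if "j \<in> I" for x j
  proof -
    have "W' j = [True] @ W j" using that insert.hyps by (auto simp: W'_def)
    moreover have "x \<in> cyl [True] \<longleftrightarrow> x 0" by (simp add: cyl_def)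
    ultimately show ?thesis using cyl_append[of x "[True]" "W j"] by simp
  qed
  have "\<exists>!j. j \<in> insert i I \<and> x \<in> cyl (W' j)" for x
  proof (cases "x 0")
    case True
    obtain j where "j \<in> I" "suffix 1 x \<in> cyl (W j)" by (rule complete_codeE[OF W])
    then show ?thesis using True new old complete_code_unique[OF W]
      by (intro ex1I[of _ j]) auto
  next
    case False
    then show ?thesis using new old by (intro ex1I[of _ i]) auto
  qed
  then show ?case unfolding complete_code_def by blast
qed

text \<open>
  Each cylinder of the given code is cut into one piece for each index in the fibre above it. This one
  construction serves three times: to cut the words into vertices, and the vertices into their
  outgoing edges (\<open>p = fst\<close>) and into their incoming edges (\<open>p = snd\<close>).
\<close>

lemma complete_code_refine:
  assumes fin: "finite I" and surj: "p ` I = J" and V: "complete_code J V"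
  shows "\<exists>W. complete_code I W \<and> (\<forall>i\<in>I. cyl (W i) \<subseteq> cyl (V (p i)))"
proof -
  have "\<exists>U. complete_code {i \<in> I. p i = j} U" if "j \<in> J" for j
    using that surj fin by (intro complete_code_exists) auto
  then obtain U where U: "\<And>j. j \<in> J \<Longrightarrow> complete_code {i \<in> I. p i = j} (U j)" by metis
  define W where "W = (\<lambda>i. V (p i) @ U (p i) i)"
  have mem: "x \<in> cyl (W i) \<longleftrightarrow> x \<in> cyl (V (p i)) \<and> suffix (length (V (p i))) x \<in> cyl (U (p i) i)"
    for x i by (simp add: W_def cyl_append)
  have "\<exists>!i. i \<in> I \<and> x \<in> cyl (W i)" for x
  proof -
    obtain j where j: "j \<in> J" "x \<in> cyl (V j)" by (rule complete_codeE[OF V])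
    obtain i where i: "i \<in> {i \<in> I. p i = j}" "suffix (length (V j)) x \<in> cyl (U j i)"
      by (rule complete_codeE[OF U[OF j(1)]])
    show ?thesis
    proof (intro ex1I[of _ i] conjI)
      show "i \<in> I" "x \<in> cyl (W i)" using i j mem by auto
      fix i' assume i': "i' \<in> I \<and> x \<in> cyl (W i')"
      then have "p i' = j" using complete_code_unique[OF V _ j(1) _ j(2)] mem surj by blast
      then show "i' = i" using i' i mem complete_code_unique[OF U[OF j(1)]] by blast
    qed
  qed
  then show ?thesis using mem unfolding complete_code_def by blast
qed

section \<open>Prefix exchange\<close>

text \<open>
  On the cylinder of \<open>D i\<close> the prefix \<open>D i\<close> is replaced by \<open>R i\<close>. When both codes are complete,
  these maps are the elements of Thompson's group \<open>V\<close>.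
\<close>

definition exchange :: "'i set \<Rightarrow> ('i \<Rightarrow> bool list) \<Rightarrow> ('i \<Rightarrow> bool list) \<Rightarrow> cantor \<Rightarrow> cantor" where
  "exchange I D R x =
    (let i = THE i. i \<in> I \<and> x \<in> cyl (D i) in R i \<frown> suffix (length (D i)) x)"

lemma exchange_eq:
  assumes "complete_code I D" "i \<in> I" "x \<in> cyl (D i)"
  shows "exchange I D R x = R i \<frown> suffix (length (D i)) x"
proof -
  have "(THE i. i \<in> I \<and> x \<in> cyl (D i)) = i"
    using assms complete_code_unique[OF assms(1)] by (intro the_equality) auto
  then show ?thesis by (simp add: exchange_def Let_def)
qed

lemma exchange_mem:
  assumes "complete_code I D" "i \<in> I" "x \<in> cyl (D i)"
  shows "exchange I D R x \<in> cyl (R i)"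
  using exchange_eq[OF assms] conc_mem_cyl by simp

lemma continuous_exchange:
  assumes D: "complete_code I D"
  shows "continuous_on UNIV (exchange I D R)"
proof -
  have "continuous_on (cyl (D i)) (exchange I D R)" if "i \<in> I" for i
  proof (rule continuous_on_eq)
    show "R i \<frown> suffix (length (D i)) x = exchange I D R x" if "x \<in> cyl (D i)" for x
      using exchange_eq[OF D \<open>i \<in> I\<close> that] by simp
    show "continuous_on (cyl (D i)) (\<lambda>x. R i \<frown> suffix (length (D i)) x)"
    proof (rule continuous_on_coordinatewise_then_product)
      fix n
      show "continuous_on (cyl (D i)) (\<lambda>x. (R i \<frown> suffix (length (D i)) x) n)"
        by (cases "n < length (R i)")
          (auto simp: suffix_def intro: continuous_on_subset[OF continuous_on_product_coordinates])
    qed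
  qed
  then have "continuous_on (\<Union>i\<in>I. cyl (D i)) (exchange I D R)"
    by (intro continuous_on_open_UN open_cyl)
  moreover have "(\<Union>i\<in>I. cyl (D i)) = UNIV" using complete_codeE[OF D] by blast
  ultimately show ?thesis by simp
qed

lemma exchange_inverse:
  assumes "complete_code I D" "complete_code I R"
  shows "exchange I R D (exchange I D R x) = x"
proof -
  obtain i where i: "i \<in> I" "x \<in> cyl (D i)" by (rule complete_codeE[OF assms(1)])
  then show ?thesis
    using exchange_eq[OF assms(1) i, of R] exchange_eq[OF assms(2) i(1) conc_mem_cyl, of D]
    by (simp add: suffix_conc_same conc_suffix_same)
qed

lemma homeomorphism_exchange:
  assumes "complete_code I D" "complete_code I R"
  shows "homeomorphism UNIV UNIV (exchange I D R) (exchange I R D)"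
  using assms by (intro homeomorphismI continuous_exchange exchange_inverse) auto

text \<open>
  The exchange is indexed by the edges: the edge \<open>(a, b)\<close> carries a piece of the cylinder of \<open>a\<close>
  to a piece of the cylinder of \<open>b\<close>. Vertices without incoming edges leave part of the space outside
  the image, which costs bijectivity but not continuity.
\<close>

lemma realise_digraph:
  assumes fin: "finite V" and W: "complete_code V W" and E: "E \<subseteq> V \<times> V"
    and out: "\<forall>v\<in>V. \<exists>w. (v, w) \<in> E"
  shows "\<exists>g\<in>cantor_maps. (\<forall>x. \<exists>(a, b)\<in>E. x \<in> cyl (W a) \<and> g x \<in> cyl (W b)) \<and>
    (\<forall>a\<in>V. \<forall>b\<in>V. g ` cyl (W a) \<inter> cyl (W b) \<noteq> {} \<longleftrightarrow> (a, b) \<in> E) \<and>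
    ((\<forall>w\<in>V. \<exists>v. (v, w) \<in> E) \<longrightarrow> g \<in> cantor_homeos)"
proof -
  have finE: "finite E" using E fin finite_subset by blast
  have "fst ` E = V" using E out by force
  then obtain D where D: "complete_code E D" "\<And>e. e \<in> E \<Longrightarrow> cyl (D e) \<subseteq> cyl (W (fst e))"
    using complete_code_refine[OF finE _ W] by blast
  obtain R where R: "\<And>e. e \<in> E \<Longrightarrow> cyl (R e) \<subseteq> cyl (W (snd e))"
    and Rcode: "(\<forall>w\<in>V. \<exists>v. (v, w) \<in> E) \<Longrightarrow> complete_code E R"
  proof (cases "\<forall>w\<in>V. \<exists>v. (v, w) \<in> E")
    case True
    then have "snd ` E = V" using E by force
    then show ?thesis using complete_code_refine[OF finE _ W] that by blast
  next
    case False
    \<comment> \<open>Here the images of different edges may overlap, so whole target cylinders will do.\<close>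
    then show ?thesis using that[of "\<lambda>e. W (snd e)"] by blast
  qed
  define g where "g = exchange E D R"
  have step: "\<exists>(a, b)\<in>E. x \<in> cyl (W a) \<and> g x \<in> cyl (W b)" for x
  proof -
    obtain e where e: "e \<in> E" "x \<in> cyl (D e)" by (rule complete_codeE[OF D(1)])
    then have "x \<in> cyl (W (fst e))" "g x \<in> cyl (W (snd e))"
      using D(2) R exchange_mem[OF D(1) e] unfolding g_def by blast+
    then show ?thesis using e by force
  qed
  have "g ` cyl (W a) \<inter> cyl (W b) \<noteq> {} \<longleftrightarrow> (a, b) \<in> E" if "a \<in> V" "b \<in> V" for a b
  proof
    assume "g ` cyl (W a) \<inter> cyl (W b) \<noteq> {}"
    then obtain x where x: "x \<in> cyl (W a)" "g x \<in> cyl (W b)" by blast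
    obtain a' b' where ab': "(a', b') \<in> E" "x \<in> cyl (W a')" "g x \<in> cyl (W b')"
      using step[of x] by blast
    then have "a' = a" "b' = b" using x that E complete_code_unique[OF W] by blast+
    then show "(a, b) \<in> E" using ab' by simp
  next
    assume e: "(a, b) \<in> E"
    obtain x where x: "x \<in> cyl (D (a, b))" using cyl_nonempty by blast
    then have "x \<in> cyl (W a)" "g x \<in> cyl (W b)"
      using D(2)[OF e] R[OF e] exchange_mem[OF D(1) e x] unfolding g_def by auto
    then show "g ` cyl (W a) \<inter> cyl (W b) \<noteq> {}" by blast
  qed
  moreover have "g \<in> cantor_maps"
    unfolding g_def cantor_maps_def using continuous_exchange[OF D(1)] by simp
  moreover have "g \<in> cantor_homeos" if "\<forall>w\<in>V. \<exists>v. (v, w) \<in> E"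
    unfolding g_def cantor_homeos_def using homeomorphism_exchange[OF D(1) Rcode[OF that]] by blast
  ultimately show ?thesis using step by blast
qed

section \<open>Uniform continuity and the two metrics\<close>

lemma open_contains_cyl:
  assumes "open U" "x \<in> U"
  shows "\<exists>N. cyl (map x [0..<N]) \<subseteq> U"
proof -
  have "openin cantor.mtopology U" using assms by (simp add: cantor_mtopology)
  then obtain r where r: "r > 0" "cantor.mball x r \<subseteq> U"
    using assms cantor.openin_mtopology by blast
  obtain N where N: "1 / real (Suc N) < r" using nat_approx_posE[OF r(1)] by blast
  have "cyl (map x [0..<Suc N]) \<subseteq> cantor.mball x r"
  proof
    fix y assume "y \<in> cyl (map x [0..<Suc N])"
    then have "\<forall>n\<le>N. x n = y n" by (auto simp: cyl_def simp del: upt_Suc)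
    then show "y \<in> cantor.mball x r"
      using N cantor_dist_less_iff[of x y N] by simp
  qed
  then show ?thesis using r(2) by blast
qed

text \<open>
  Uniform continuity in terms of coordinates: compactness reduces the local moduli, which exist
  because preimages of cylinders are open, to finitely many.
\<close>

lemma uniform_modulus:
  assumes "f \<in> cantor_maps"
  shows "\<exists>D\<ge>L. \<forall>x y. (\<forall>n<D. x n = y n) \<longrightarrow> (\<forall>n<L. f x n = f y n)"
proof -
  have "compact (UNIV :: bool set)" by (simp add: finite_imp_compact)
  then have compact: "compact (UNIV :: cantor set)"
    using compact_space_product_topology[of "\<lambda>_::nat. euclidean :: bool topology" UNIV]
    by (simp add: euclidean_product_topology compact_space_def)
  have "\<exists>N. cyl (map x [0..<N]) \<subseteq> f -` cyl (map (f x) [0..<L])" for x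
  proof (rule open_contains_cyl)
    show "open (f -` cyl (map (f x) [0..<L]))"
      using assms unfolding cantor_maps_def by (intro open_vimage open_cyl) simp
    show "x \<in> f -` cyl (map (f x) [0..<L])" by (simp add: cyl_def)
  qed
  then obtain N where N: "\<And>x. cyl (map x [0..<N x]) \<subseteq> f -` cyl (map (f x) [0..<L])" by metis
  have "UNIV \<subseteq> (\<Union>x\<in>UNIV. cyl (map x [0..<N x]))" by (auto simp: cyl_def)
  then obtain X where X: "finite X" "UNIV \<subseteq> (\<Union>x\<in>X. cyl (map x [0..<N x]))"
    by (rule compactE_image[OF compact, rotated]) (use open_cyl in auto)
  have "f x n = f y n" if xy: "\<forall>n<Max (insert L (N ` X)). x n = y n" and "n < L" for x y n
  proof -
    obtain z where z: "z \<in> X" "x \<in> cyl (map z [0..<N z])" using X(2) by blast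
    then have "N z \<le> Max (insert L (N ` X))" using X(1) by simp
    then have "y \<in> cyl (map z [0..<N z])" using z(2) xy by (simp add: cyl_def)
    then have "f x \<in> cyl (map (f z) [0..<L])" "f y \<in> cyl (map (f z) [0..<L])"
      using z(2) N by blast+
    then show ?thesis using \<open>n < L\<close> by (simp add: cyl_def)
  qed
  then show ?thesis using X(1) by (intro exI[of _ "Max (insert L (N ` X))"]) simp
qed

lemma unif_dist_less:
  assumes "\<And>x. cantor_dist (f x) (g x) \<le> r" "r < \<epsilon>"
  shows "unif_dist f g < \<epsilon>"
proof -
  have "unif_dist f g \<le> r" unfolding unif_dist_def using assms by (intro cSUP_least) auto
  then show ?thesis using assms by simp
qed

lemma mesh_less:
  assumes "finite P" "P \<noteq> {}" "\<And>A. A \<in> P \<Longrightarrow> A \<noteq> {}"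
    and "\<And>A x y. A \<in> P \<Longrightarrow> x \<in> A \<Longrightarrow> y \<in> A \<Longrightarrow> cantor_dist x y \<le> r" "r < \<epsilon>"
  shows "mesh P < \<epsilon>"
proof -
  have "cantor_diam A \<le> r" if "A \<in> P" for A
    unfolding cantor_diam_def using assms(3,4) that by (intro cSUP_least) auto
  then have "cantor_diam A < \<epsilon>" if "A \<in> P" for A using that assms(5) by fastforce
  then show ?thesis unfolding mesh_def using assms(1,2) by simp
qed

section \<open>Approximation by disjoint copies of a small digraph\<close>

definition transitions :: "(cantor \<Rightarrow> cantor) \<Rightarrow> nat \<Rightarrow> bool list rel" where
  "transitions f D = {(a, b). length a = D \<and> length b = D \<and> f ` cyl a \<inter> cyl b \<noteq> {}}"

text \<open>
  The vertices of the \<open>i\<close>-th copy are tagged by \<open>i\<close>, and \<open>\<phi>\<close> names them in \<open>G\<close>.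
\<close>

definition copies :: "nat \<Rightarrow> 'v set \<Rightarrow> 'v rel \<Rightarrow> 'a pair_pre_digraph \<Rightarrow> bool" where
  "copies k V E G \<longleftrightarrow> (\<exists>\<phi>. inj_on \<phi> ({..<k} \<times> V) \<and> pverts G = \<phi> ` ({..<k} \<times> V) \<and>
     parcs G = {(\<phi> (i, p), \<phi> (i, q)) | i p q. i < k \<and> (p, q) \<in> E})"

text \<open>
  The condition \<open>N < D\<close> makes the cylinders of depth \<open>D\<close> themselves smaller than \<open>\<epsilon>\<close>: they bound the
  mesh, and landing in the same one as \<open>f y\<close> is close enough to \<open>f y\<close>.
\<close>

definition resolves :: "(cantor \<Rightarrow> cantor) \<Rightarrow> real \<Rightarrow> nat \<Rightarrow> bool" where
  "resolves f \<epsilon> D \<longleftrightarrow> (\<exists>N<D. 1 / real (Suc N) < \<epsilon> \<and>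
     (\<forall>x y. (\<forall>n<D. x n = y n) \<longrightarrow> (\<forall>n\<le>N. f x n = f y n)))"

lemma resolves_exists:
  assumes "f \<in> cantor_maps" "\<epsilon> > 0"
  shows "\<exists>D. resolves f \<epsilon> D"
proof -
  obtain N where N: "1 / real (Suc N) < \<epsilon>" using nat_approx_posE[OF \<open>\<epsilon> > 0\<close>] by blast
  obtain D where D: "D \<ge> Suc N"
    "\<forall>x y. (\<forall>n<D. x n = y n) \<longrightarrow> (\<forall>n<Suc N. f x n = f y n)"
    using uniform_modulus[OF assms(1), of "Suc N"] by blast
  then show ?thesis using N unfolding resolves_def
    by (intro exI[of _ D] exI[of _ N]) (simp add: less_Suc_eq_le)
qed

text \<open>
  The labels \<open>\<zeta>\<close> turn a map that respects the digraph into an approximation of \<open>f\<close>: if \<open>x\<close> lies in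
  the piece of a vertex labelled \<open>a\<close> and \<open>g x\<close> in that of a vertex labelled \<open>b\<close>, then \<open>f\<close> sends
  some \<open>y\<close> in the cylinder of \<open>a\<close> into that of \<open>b\<close>, so that \<open>f x\<close> is close to \<open>f y\<close>, which is close
  to \<open>g x\<close>. The bound on \<open>k\<close> makes room for one copy through each word, so that the pieces
  cover the whole space.
\<close>

lemma approximate_by_copies:
  assumes D: "resolves f \<epsilon> D"
    and k: "card {w :: bool list. length w = D} \<le> k"
    and V: "finite V" and E: "E \<subseteq> V \<times> V" and out: "\<forall>p\<in>V. \<exists>q. (p, q) \<in> E"
    and walk: "\<And>a. length a = D \<Longrightarrow> \<exists>\<zeta>. a \<in> \<zeta> ` V \<and> (\<forall>(p, q)\<in>E. (\<zeta> p, \<zeta> q) \<in> transitions f D)"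
  shows "\<exists>g\<in>cantor_maps. \<exists>P. clopen_partition P \<and> unif_dist f g < \<epsilon> \<and> mesh P < \<epsilon> \<and>
    copies k V E (Gr g P) \<and> ((\<forall>q\<in>V. \<exists>p. (p, q) \<in> E) \<longrightarrow> g \<in> cantor_homeos)"
proof -
  obtain N where ND: "N < D" and N: "1 / real (Suc N) < \<epsilon>"
    and modulus: "\<And>x y. \<forall>n<D. x n = y n \<Longrightarrow> \<forall>n\<le>N. f x n = f y n"
    using D unfolding resolves_def by blast
  define A where "A = {w :: bool list. length w = D}"
  have finA: "finite A" using finite_lists_length_eq[of "UNIV :: bool set" D] by (simp add: A_def)
  have near: "cantor_dist x y \<le> 1 / real (Suc N)" if "\<forall>n\<le>N. x n = y n" for x y
    using that cantor_dist_less_iff[of x y N] by simp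
  obtain \<zeta> where \<zeta>: "\<And>a. a \<in> A \<Longrightarrow> a \<in> \<zeta> a ` V"
    "\<And>a p q. a \<in> A \<Longrightarrow> (p, q) \<in> E \<Longrightarrow> (\<zeta> a p, \<zeta> a q) \<in> transitions f D"
  proof -
    have "\<exists>\<zeta>. \<forall>a\<in>A. a \<in> \<zeta> a ` V \<and> (\<forall>(p, q)\<in>E. (\<zeta> a p, \<zeta> a q) \<in> transitions f D)"
      using walk by (intro bchoice) (simp add: A_def)
    then show ?thesis using that by blast
  qed
  have \<zeta>A: "\<zeta> a p \<in> A" if "a \<in> A" "p \<in> V" for a p
    using out \<zeta>(2) that by (auto simp: transitions_def A_def)
  have "replicate D True \<in> A" by (simp add: A_def)
  then have A0: "0 < card A" using finA card_gt_0_iff by blast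
  obtain h where h: "bij_betw h {0..<card A} A" using ex_bij_betw_nat_finite[OF finA] by blast
  \<comment> \<open>The copy number \<open>i\<close> runs through the word \<open>e i\<close>; the copies in excess repeat the word \<open>h 0\<close>.\<close>
  define e where "e i = (if i < card A then h i else h 0)" for i
  have e: "e ` {..<k} = A"
  proof
    show "e ` {..<k} \<subseteq> A" using bij_betwE[OF h] A0 by (auto simp: e_def)
    show "A \<subseteq> e ` {..<k}"
    proof
      fix a assume "a \<in> A"
      then obtain i where "i < card A" "h i = a"
        using bij_betw_imp_surj_on[OF h] by (metis atLeastLessThan_iff imageE)
      then show "a \<in> e ` {..<k}" using k[folded A_def] by (intro image_eqI[of _ _ i]) (auto simp: e_def)
    qed
  qed
  define lab where "lab = (\<lambda>(i, p). \<zeta> (e i) p)"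
  define VV where "VV = {..<k} \<times> V"
  define EE where "EE = {((i, p), (i, q)) | i p q. i < k \<and> (p, q) \<in> E}"
  have finVV: "finite VV" using V by (simp add: VV_def)
  have EE: "EE \<subseteq> VV \<times> VV" using E by (auto simp: EE_def VV_def)
  have "lab ` VV = A"
  proof
    show "lab ` VV \<subseteq> A" using e \<zeta>A by (auto simp: lab_def VV_def)
    show "A \<subseteq> lab ` VV"
    proof
      fix a assume a: "a \<in> A"
      obtain i where "i < k" "e i = a" using a e by blast
      moreover obtain p where "p \<in> V" "\<zeta> a p = a" using \<zeta>(1)[OF a] by force
      ultimately show "a \<in> lab ` VV"
        by (intro image_eqI[of _ _ "(i, p)"]) (auto simp: lab_def VV_def)
    qed
  qed
  then obtain W where W: "complete_code VV W" "\<And>v. v \<in> VV \<Longrightarrow> cyl (W v) \<subseteq> cyl (lab v)"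
    using complete_code_refine[OF finVV, of lab A "\<lambda>w. w"] complete_code_words[of D]
    unfolding A_def by blast
  have outVV: "\<forall>v\<in>VV. \<exists>w. (v, w) \<in> EE"
    using out by (force simp: VV_def EE_def)
  obtain g where g: "g \<in> cantor_maps"
    and step: "\<forall>x. \<exists>(a, b)\<in>EE. x \<in> cyl (W a) \<and> g x \<in> cyl (W b)"
    and edge: "\<forall>a\<in>VV. \<forall>b\<in>VV. g ` cyl (W a) \<inter> cyl (W b) \<noteq> {} \<longleftrightarrow> (a, b) \<in> EE"
    and homeo: "(\<forall>w\<in>VV. \<exists>v. (v, w) \<in> EE) \<longrightarrow> g \<in> cantor_homeos"
    using realise_digraph[OF finVV W(1) EE outVV] by (elim bexE conjE) (rule that; assumption)
  define P where "P = (\<lambda>v. cyl (W v)) ` VV"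
  have inj: "inj_on (\<lambda>v. cyl (W v)) VV"
    using complete_code_unique[OF W(1)] cyl_nonempty by (intro inj_onI) blast
  have P: "clopen_partition P"
    unfolding clopen_partition_def
  proof (intro conjI ballI)
    show "finite P" using finVV by (simp add: P_def)
    show "partition_on UNIV P"
    proof (rule partition_onI)
      show "\<Union>P = UNIV" using complete_codeE[OF W(1)] unfolding P_def by blast
      show "disjnt a b" if "a \<in> P" "b \<in> P" "a \<noteq> b" for a b
        using that complete_code_unique[OF W(1)] unfolding P_def disjnt_def by blast
      show "{} \<notin> P" using cyl_nonempty unfolding P_def by force
    qed
  qed (auto simp: P_def open_cyl closed_cyl)
  have "unif_dist f g < \<epsilon>"
  proof (rule unif_dist_less[OF near N])
    fix x
    obtain i p q where pq: "i < k" "(p, q) \<in> E" "x \<in> cyl (W (i, p))" "g x \<in> cyl (W (i, q))"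
      using step[rule_format, of x] by (auto simp: EE_def)
    then have "(i, p) \<in> VV" "(i, q) \<in> VV" using E by (auto simp: VV_def)
    then have xa: "x \<in> cyl (\<zeta> (e i) p)" and gb: "g x \<in> cyl (\<zeta> (e i) q)"
      using pq W(2)[of "(i, p)"] W(2)[of "(i, q)"] by (auto simp: lab_def)
    have "e i \<in> A" using pq(1) e by blast
    then have t: "(\<zeta> (e i) p, \<zeta> (e i) q) \<in> transitions f D" using pq(2) \<zeta>(2) by blast
    then obtain y where y: "y \<in> cyl (\<zeta> (e i) p)" "f y \<in> cyl (\<zeta> (e i) q)"
      by (auto simp: transitions_def)
    have "\<forall>n<D. x n = y n" "\<forall>n<D. f y n = g x n"
      using t xa gb y by (auto simp: transitions_def cyl_def)
    then show "\<forall>n\<le>N. f x n = g x n" using modulus[of x y] ND by fastforce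
  qed
  moreover have "mesh P < \<epsilon>"
  proof (rule mesh_less[OF _ _ _ near N])
    show "finite P" using finVV by (simp add: P_def)
    show "P \<noteq> {}" using complete_codeE[OF W(1)] unfolding P_def by blast
    show "B \<noteq> {}" if "B \<in> P" for B using that cyl_nonempty unfolding P_def by blast
    fix B x y assume B: "B \<in> P" "x \<in> B" "y \<in> B"
    then obtain v where v: "v \<in> VV" "x \<in> cyl (lab v)" "y \<in> cyl (lab v)"
      using W(2) unfolding P_def by blast
    then have "length (lab v) = D" using \<open>lab ` VV = A\<close> A_def by blast
    then show "\<forall>n\<le>N. x n = y n" using v(2,3) ND by (simp add: cyl_def)
  qed
  moreover have "copies k V E (Gr g P)"
  proof -
    have "parcs (Gr g P) = {(cyl (W a), cyl (W b)) | a b. a \<in> VV \<and> b \<in> VV \<and> g ` cyl (W a) \<inter> cyl (W b) \<noteq> {}}"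
      unfolding Gr_def P_def pair_pre_digraph.simps by blast
    also have "\<dots> = {(cyl (W a), cyl (W b)) | a b. (a, b) \<in> EE}"
      using edge EE by (intro Collect_cong ex_cong1) blast
    also have "\<dots> = {(cyl (W (i, p)), cyl (W (i, q))) | i p q. i < k \<and> (p, q) \<in> E}"
      unfolding EE_def by blast
    finally show ?thesis
      using inj unfolding copies_def
      by (intro exI[of _ "\<lambda>v. cyl (W v)"]) (simp add: Gr_def P_def VV_def)
  qed
  moreover have "g \<in> cantor_homeos" if "\<forall>q\<in>V. \<exists>p. (p, q) \<in> E"
    using that by (intro homeo[rule_format]) (force simp: VV_def EE_def)
  ultimately show "\<exists>g\<in>cantor_maps. \<exists>P. clopen_partition P \<and> unif_dist f g < \<epsilon> \<and> mesh P < \<epsilon> \<and>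
      copies k V E (Gr g P) \<and> ((\<forall>q\<in>V. \<exists>p. (p, q) \<in> E) \<longrightarrow> g \<in> cantor_homeos)"
    using g P by blast
qed

lemma copies_consists_of_disjoint:
  assumes "copies k V E G" and "E \<subseteq> V \<times> V"
    and Q: "\<And>\<psi>. inj_on \<psi> V \<Longrightarrow> Q \<lparr>pverts = \<psi> ` V, parcs = map_prod \<psi> \<psi> ` E\<rparr>"
  shows "consists_of_disjoint k Q G"
proof -
  obtain \<phi> where \<phi>: "inj_on \<phi> ({..<k} \<times> V)" "pverts G = \<phi> ` ({..<k} \<times> V)"
    "parcs G = {(\<phi> (i, p), \<phi> (i, q)) | i p q. i < k \<and> (p, q) \<in> E}"
    using assms(1) unfolding copies_def by blast
  define \<psi> where "\<psi> i p = \<phi> (i, p)" for i p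
  define H where "H i = \<lparr>pverts = \<psi> i ` V, parcs = map_prod (\<psi> i) (\<psi> i) ` E\<rparr>" for i
  have "inj_on (\<psi> i) V" if "i < k" for i
    using that \<phi>(1) unfolding inj_on_def \<psi>_def by blast
  then have "Q (H i)" if "i < k" for i using that Q unfolding H_def by blast
  moreover have "disjoint_family_on (\<lambda>i. pverts (H i)) {..<k}"
    using \<phi>(1) unfolding disjoint_family_on_def H_def \<psi>_def inj_on_def by fastforce
  moreover have "pverts G = (\<Union>i<k. pverts (H i))"
    unfolding \<phi>(2) H_def \<psi>_def by auto
  moreover have "parcs G = (\<Union>i<k. parcs (H i))"
    unfolding \<phi>(3) H_def \<psi>_def by force
  ultimately show ?thesis unfolding consists_of_disjoint_def by blast
qed

section \<open>Balloons and dumbbells as paths with return edges\<close>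

text \<open>
  The vertices of a balloon or dumbbell are numbered along a path that runs through all of
  them, so that only one or two edges lead back and a labelling is just a walk. In the dumbbell of
  type \<open>(n, s, m)\<close> the path enters the first cycle at \<open>u\<^sub>2\<close> and reaches \<open>u\<^sub>1\<close>, the vertex
  attached to the bar, last: \<open>u\<^sub>1\<close> has number \<open>n\<close>, and \<open>u\<^sub>i\<close> has number \<open>i - 1\<close> for \<open>i \<ge> 2\<close>.
\<close>

definition path_edges :: "nat \<Rightarrow> nat rel" where
  "path_edges T = {(j, Suc j) | j. 1 \<le> j \<and> j < T}"

definition balloon_edges :: "nat \<Rightarrow> nat \<Rightarrow> nat rel" where
  "balloon_edges s m = path_edges (s + m) \<union> {(s + m, s + 1)}"

definition dumbbell_edges :: "nat \<Rightarrow> nat \<Rightarrow> nat \<Rightarrow> nat rel" where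
  "dumbbell_edges n s m = path_edges (n + s + m) \<union> {(n, 1), (n + s + m, n + s + 1)}"

lemma image_pairs:
  "map_prod \<psi> \<psi> ` {(f i, g i) | i. C i} = {(\<psi> (f i), \<psi> (g i)) | i. C i}"
  by force

lemma balloon_copy:
  assumes "1 \<le> s" "1 \<le> m" "inj_on \<psi> {1..s + m}"
  shows "balloon s m \<lparr>pverts = \<psi> ` {1..s + m}, parcs = map_prod \<psi> \<psi> ` balloon_edges s m\<rparr>"
proof -
  have verts: "{1..s + m} = {1..s} \<union> (+) s ` {1..m}" using assms by auto
  have edges: "balloon_edges s m = {(i, i + 1) | i. 1 \<le> i \<and> i < s}
      \<union> {(s + j, s + (j + 1)) | j. 1 \<le> j \<and> j < m} \<union> {(s + m, s + 1), (s, s + 1)}" (is "_ = ?R")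
  proof
    show "balloon_edges s m \<subseteq> ?R"
    proof
      fix e assume "e \<in> balloon_edges s m"
      then consider "e = (s + m, s + 1)" | p where "e = (p, Suc p)" "1 \<le> p" "p < s + m"
        by (auto simp: balloon_edges_def path_edges_def)
      then show "e \<in> ?R"
      proof cases
        case (2 p)
        then have "p < s \<or> p = s \<or> (\<exists>i. p = s + i \<and> 1 \<le> i \<and> i < m)" by presburger
        then show ?thesis using 2 by auto
      qed simp
    qed
    show "?R \<subseteq> balloon_edges s m"
      using assms by (auto simp: balloon_edges_def path_edges_def)
  qed
  show ?thesis
    unfolding balloon_def
  proof (intro conjI exI)
    let ?v = \<psi> and ?w = "\<lambda>j. \<psi> (s + j)"
    have sub: "{1..s} \<subseteq> {1..s + m}" "(+) s ` {1..m} \<subseteq> {1..s + m}"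
      unfolding verts by blast+
    show "inj_on ?v {1..s}" by (rule inj_on_subset[OF assms(3) sub(1)])
    show "inj_on ?w {1..m}"
      using sub(2)[THEN inj_on_subset[OF assms(3)], THEN comp_inj_on[rotated]] by (simp add: comp_def)
    have "{1..s} \<inter> (+) s ` {1..m} = {}" by auto
    then show "?v ` {1..s} \<inter> ?w ` {1..m} = {}"
      using inj_on_image_Int[OF assms(3) sub, symmetric] by (simp only: image_image image_empty)
    show "pverts \<lparr>pverts = \<psi> ` {1..s + m}, parcs = map_prod \<psi> \<psi> ` balloon_edges s m\<rparr>
        = ?v ` {1..s} \<union> ?w ` {1..m}"
      unfolding verts by (simp only: pair_pre_digraph.simps image_Un image_image)
    show "parcs \<lparr>pverts = \<psi> ` {1..s + m}, parcs = map_prod \<psi> \<psi> ` balloon_edges s m\<rparr>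
        = {(?v i, ?v (i + 1)) | i. 1 \<le> i \<and> i < s}
          \<union> {(?w j, ?w (j + 1)) | j. 1 \<le> j \<and> j < m} \<union> {(?w m, ?w 1), (?v s, ?w 1)}"
      unfolding edges by (simp only: image_Un image_pairs image_insert image_empty map_prod_simp
        pair_pre_digraph.simps)
  qed (use assms in auto)
qed

lemma dumbbell_copy:
  assumes "1 \<le> n" "1 \<le> s" "1 \<le> m" "inj_on \<psi> {1..n + s + m}"
  shows "dumbbell n s m
    \<lparr>pverts = \<psi> ` {1..n + s + m}, parcs = map_prod \<psi> \<psi> ` dumbbell_edges n s m\<rparr>"
proof -
  define u where "u i = (if i = 1 then n else i - 1)" for i :: nat
  have u_image: "u ` {1..n} = {1..n}"
  proof -
    have "u ` {1..n} \<subseteq> {1..n}" using assms by (auto simp: u_def)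
    moreover have inj: "inj_on u {1..n}" by (auto simp: inj_on_def u_def)
    ultimately show ?thesis by (simp add: endo_inj_surj)
  qed
  have verts: "{1..n + s + m} = u ` {1..n} \<union> (+) n ` {1..s} \<union> (+) (n + s) ` {1..m}"
    unfolding u_image using assms by auto
  have edges: "dumbbell_edges n s m = {(u i, u (i + 1)) | i. 1 \<le> i \<and> i < n} \<union> {(u n, u 1)}
      \<union> {(n + s + i, n + s + (i + 1)) | i. 1 \<le> i \<and> i < m} \<union> {(n + s + m, n + s + 1)}
      \<union> {(n + i, n + (i + 1)) | i. 1 \<le> i \<and> i < s} \<union> {(u 1, n + 1), (n + s, n + s + 1)}"
    (is "_ = ?R")
  proof
    show "dumbbell_edges n s m \<subseteq> ?R"
    proof
      fix e assume "e \<in> dumbbell_edges n s m"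
      then consider "e = (n, 1)" | "e = (n + s + m, n + s + 1)"
        | p where "e = (p, Suc p)" "1 \<le> p" "p < n + s + m"
        by (auto simp: dumbbell_edges_def path_edges_def)
      then show "e \<in> ?R"
      proof cases
        case 1
        \<comment> \<open>For \<open>n = 1\<close> the edge \<open>(n, 1)\<close> is the loop at \<open>u\<^sub>1\<close>, otherwise it is the edge from \<open>u\<^sub>1\<close> to \<open>u\<^sub>2\<close>.\<close>
        show ?thesis
        proof (cases "n = 1")
          case True
          then have "e = (u n, u 1)" using 1 by (simp add: u_def)
          then show ?thesis by simp
        next
          case False
          then have "e = (u 1, u (1 + 1)) \<and> 1 < n" using 1 assms(1) by (simp add: u_def)
          then show ?thesis by blast
        qed
      next
        case (3 p)
        then consider "p < n" | "p = n \<or> p = n + s"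
          | i where "p = n + i" "1 \<le> i" "i < s" | i where "p = n + s + i" "1 \<le> i" "i < m"
          by atomize_elim presburger
        then show ?thesis
        proof cases
          case 1
          have "e = (u (p + 1), u (p + 1 + 1))" "p + 1 = n \<Longrightarrow> e = (u n, u 1)"
            using 3 by (auto simp: u_def)
          then show ?thesis using 1 by (cases "p + 1 = n") auto
        qed (use 3 in \<open>auto simp: u_def\<close>)
      qed simp
    qed
    show "?R \<subseteq> dumbbell_edges n s m"
      using assms by (auto simp: dumbbell_edges_def path_edges_def u_def)
  qed
  show ?thesis
    unfolding dumbbell_def
  proof (intro conjI exI)
    let ?u = "\<lambda>i. \<psi> (u i)" and ?v = "\<lambda>j. \<psi> (n + j)" and ?w = "\<lambda>j. \<psi> (n + s + j)"
    have sub: "u ` {1..n} \<subseteq> {1..n + s + m}" "(+) n ` {1..s} \<subseteq> {1..n + s + m}"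
      "(+) (n + s) ` {1..m} \<subseteq> {1..n + s + m}"
      unfolding verts by blast+
    have "inj_on u {1..n}" by (auto simp: inj_on_def u_def)
    then show "inj_on ?u {1..n}" "inj_on ?v {1..s}" "inj_on ?w {1..m}"
      using sub[THEN inj_on_subset[OF assms(4)], THEN comp_inj_on[rotated]] by (simp_all add: comp_def)
    have disj: "u ` {1..n} \<inter> (+) n ` {1..s} = {}" "u ` {1..n} \<inter> (+) (n + s) ` {1..m} = {}"
      "(+) n ` {1..s} \<inter> (+) (n + s) ` {1..m} = {}"
      unfolding u_image by auto
    show "?u ` {1..n} \<inter> ?v ` {1..s} = {}" "?u ` {1..n} \<inter> ?w ` {1..m} = {}"
      "?v ` {1..s} \<inter> ?w ` {1..m} = {}"
      using inj_on_image_Int[OF assms(4) sub(1,2), symmetric]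
        inj_on_image_Int[OF assms(4) sub(1,3), symmetric]
        inj_on_image_Int[OF assms(4) sub(2,3), symmetric]
      by (simp_all only: disj image_image image_empty)
    show "pverts \<lparr>pverts = \<psi> ` {1..n + s + m}, parcs = map_prod \<psi> \<psi> ` dumbbell_edges n s m\<rparr>
        = ?u ` {1..n} \<union> ?v ` {1..s} \<union> ?w ` {1..m}"
      unfolding verts by (simp only: pair_pre_digraph.simps image_Un image_image)
    show "parcs \<lparr>pverts = \<psi> ` {1..n + s + m}, parcs = map_prod \<psi> \<psi> ` dumbbell_edges n s m\<rparr>
        = {(?u i, ?u (i + 1)) | i. 1 \<le> i \<and> i < n} \<union> {(?u n, ?u 1)}
          \<union> {(?w i, ?w (i + 1)) | i. 1 \<le> i \<and> i < m} \<union> {(?w m, ?w 1)}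
          \<union> {(?v i, ?v (i + 1)) | i. 1 \<le> i \<and> i < s} \<union> {(?u 1, ?v 1), (?v s, ?w 1)}"
      unfolding edges by (simp only: image_Un image_pairs image_insert image_empty map_prod_simp
        pair_pre_digraph.simps)
  qed (use assms in auto)
qed

section \<open>Eventually periodic walks\<close>

text \<open>
  Among the first \<open>card A + 1\<close> iterates two coincide; their distance is a period, is at most
  \<open>card A\<close>, and hence divides \<open>fact (card A)\<close>.
\<close>

lemma funpow_fact_periodic:
  assumes "finite A" "h ` A \<subseteq> A" "a \<in> A" "card A \<le> j" "fact (card A) dvd m"
  shows "(h ^^ (j + m)) a = (h ^^ j) a"
proof -
  have inA: "(h ^^ i) a \<in> A" for i using assms(2,3) by (induction i) auto
  have "\<not> inj_on (\<lambda>i. (h ^^ i) a) {..card A}"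
  proof
    assume "inj_on (\<lambda>i. (h ^^ i) a) {..card A}"
    then have "card {..card A} \<le> card A" using inA assms(1) by (intro card_inj_on_le) auto
    then show False by simp
  qed
  then obtain i i' where i: "i < i'" "i' \<le> card A" "(h ^^ i) a = (h ^^ i') a"
    unfolding inj_on_def by (metis atMost_iff linorder_neqE_nat)
  define d where "d = i' - i"
  have per: "(h ^^ (l + d)) a = (h ^^ l) a" if "i \<le> l" for l
  proof -
    have "l + d = (l - i) + i'" "l = (l - i) + i" using that i by (simp_all add: d_def)
    then show ?thesis using i(3) by (metis comp_apply funpow_add)
  qed
  have "(h ^^ (j + d * l)) a = (h ^^ j) a" for l
  proof (induction l)
    case (Suc l)
    then show ?case using per[of "j + d * l"] i assms(4) by (simp add: algebra_simps)
  qed simp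
  moreover have "d dvd m"
    using dvd_trans[OF dvd_fact[of d "card A"] assms(5)] i by (simp add: d_def)
  ultimately show ?thesis by (auto elim: dvdE)
qed

lemma choose_steps:
  assumes "\<And>a. a \<in> A \<Longrightarrow> \<exists>b\<in>A. (a, b) \<in> R"
  obtains h where "h ` A \<subseteq> A" "\<And>a i. a \<in> A \<Longrightarrow> ((h ^^ i) a, (h ^^ Suc i) a) \<in> R"
proof -
  obtain h where h: "\<And>a. a \<in> A \<Longrightarrow> h a \<in> A \<and> (a, h a) \<in> R" using assms by metis
  have "(h ^^ i) a \<in> A" if "a \<in> A" for a i using that h by (induction i) auto
  then show thesis using that[of h] h by auto
qed

text \<open>
  Follow chosen successors from \<open>a\<close>. After \<open>card A\<close> steps, hence on the whole loop and at the end
  of the tail, the walk is periodic with a period dividing \<open>m\<close>. So the positions \<open>s\<close> and \<open>s + m\<close>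
  carry the same label, and the return edge may reuse the step that leaves position \<open>s\<close>.
\<close>

lemma balloon_walk:
  assumes "finite A" and "\<And>a. a \<in> A \<Longrightarrow> \<exists>b\<in>A. (a, b) \<in> R"
    and "a \<in> A" "card A < s" "fact (card A) dvd m"
  shows "\<exists>\<zeta>. a \<in> \<zeta> ` {1..s + m} \<and> (\<forall>(p, q)\<in>balloon_edges s m. (\<zeta> p, \<zeta> q) \<in> R)"
proof -
  obtain h where h: "h ` A \<subseteq> A" "\<And>a i. a \<in> A \<Longrightarrow> ((h ^^ i) a, (h ^^ Suc i) a) \<in> R"
    using choose_steps assms(2) by blast
  define \<zeta> where "\<zeta> j = (h ^^ (j - 1)) a" for j
  have step: "(\<zeta> j, \<zeta> (Suc j)) \<in> R" if "1 \<le> j" for j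
    using h(2)[OF assms(3), of "j - 1"] that by (simp add: \<zeta>_def)
  have "\<zeta> (s + m) = \<zeta> s"
    using funpow_fact_periodic[OF assms(1) h(1) assms(3), of "s - 1" m] assms(4,5)
    by (simp add: \<zeta>_def)
  then have "(\<zeta> (s + m), \<zeta> (s + 1)) \<in> R" using step[of s] assms(4) by simp
  moreover have "a \<in> \<zeta> ` {1..s + m}"
    using assms(4) by (intro image_eqI[of _ _ 1]) (auto simp: \<zeta>_def)
  ultimately show ?thesis
    using step by (intro exI[of _ \<zeta>]) (auto simp: balloon_edges_def path_edges_def)
qed

text \<open>
  Place \<open>a\<close> on the bar, \<open>card A\<close> steps after the first cycle, and walk from there
  backwards along chosen predecessors and forwards along chosen successors. A bar of length at least
  \<open>2 * card A\<close> leaves both directions enough room to become periodic before they reach the cycles.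
\<close>

lemma dumbbell_walk:
  assumes "finite A" and succ: "\<And>a. a \<in> A \<Longrightarrow> \<exists>b\<in>A. (a, b) \<in> R"
    and pred: "\<And>b. b \<in> A \<Longrightarrow> \<exists>a\<in>A. (a, b) \<in> R"
    and "a \<in> A" "1 \<le> n" "2 * card A \<le> s" "fact (card A) dvd n" "fact (card A) dvd m"
  shows "\<exists>\<zeta>. a \<in> \<zeta> ` {1..n + s + m} \<and> (\<forall>(p, q)\<in>dumbbell_edges n s m. (\<zeta> p, \<zeta> q) \<in> R)"
proof -
  obtain h where h: "h ` A \<subseteq> A" "\<And>a i. a \<in> A \<Longrightarrow> ((h ^^ i) a, (h ^^ Suc i) a) \<in> R"
    using choose_steps succ by blast
  have "\<exists>a\<in>A. (b, a) \<in> R\<inverse>" if "b \<in> A" for b using pred[OF that] by blast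
  then obtain l where l: "l ` A \<subseteq> A" "\<And>a i. a \<in> A \<Longrightarrow> ((l ^^ i) a, (l ^^ Suc i) a) \<in> R\<inverse>"
    using choose_steps by blast
  define c where "c = card A"
  define \<zeta> where "\<zeta> j = (if j \<le> n + c then (l ^^ (n + c - j)) a else (h ^^ (j - (n + c))) a)" for j
  have right: "\<zeta> (n + c + i) = (h ^^ i) a" for i by (cases i) (simp_all add: \<zeta>_def)
  have step: "(\<zeta> j, \<zeta> (Suc j)) \<in> R" for j
  proof (cases "j < n + c")
    case True
    then have "n + c - j = Suc (n + c - Suc j)" by simp
    then show ?thesis using l(2)[OF assms(4), of "n + c - Suc j"] True by (simp add: \<zeta>_def)
  next
    case False
    then obtain i where i: "j = n + c + i" by (metis le_Suc_ex not_less)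
    show ?thesis using h(2)[OF assms(4), of i] right[of i] right[of "Suc i"] i by simp
  qed
  \<comment> \<open>Position \<open>0\<close> is no vertex; it serves to compare the return edge \<open>(n, 1)\<close> with the step \<open>(0, 1)\<close>.\<close>
  have "\<zeta> n = \<zeta> 0"
    using funpow_fact_periodic[OF assms(1) l(1) assms(4), of c n] assms(7)
    by (simp add: \<zeta>_def c_def add.commute)
  then have "(\<zeta> n, \<zeta> 1) \<in> R" using step[of 0] by simp
  moreover have "\<zeta> (n + s + m) = \<zeta> (n + s)"
  proof -
    have "n + s + m = n + c + (s - c + m)" "n + s = n + c + (s - c)" "c \<le> s - c"
      using assms(6) by (simp_all add: c_def)
    then have "\<zeta> (n + s + m) = (h ^^ (s - c + m)) a" "\<zeta> (n + s) = (h ^^ (s - c)) a"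
      using right by metis+
    then show ?thesis
      using funpow_fact_periodic[OF assms(1) h(1) assms(4), of "s - c" m] assms(8)
        \<open>c \<le> s - c\<close> by (simp add: c_def)
  qed
  then have "(\<zeta> (n + s + m), \<zeta> (n + s + 1)) \<in> R" using step[of "n + s"] by simp
  moreover have "a \<in> \<zeta> ` {1..n + s + m}"
    using right[of 0] assms(5,6) by (intro image_eqI[of _ _ "n + c"]) (auto simp: c_def)
  ultimately show ?thesis
    using step by (intro exI[of _ \<zeta>]) (auto simp: dumbbell_edges_def path_edges_def)
qed

lemma transitions_succ:
  assumes "length a = D"
  shows "\<exists>b\<in>{w. length w = D}. (a, b) \<in> transitions f D"
proof -
  obtain x where "x \<in> cyl a" using cyl_nonempty by blast
  moreover have "f x \<in> cyl (map (f x) [0..<D])" by (simp add: cyl_def)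
  ultimately have "(a, map (f x) [0..<D]) \<in> transitions f D"
    using assms unfolding transitions_def by auto
  then show ?thesis by (rule rev_bexI[rotated]) simp
qed

lemma transitions_pred:
  assumes "surj f" "length b = D"
  shows "\<exists>a\<in>{w. length w = D}. (a, b) \<in> transitions f D"
proof -
  obtain y where "y \<in> cyl b" using cyl_nonempty by blast
  moreover obtain x where "y = f x" using assms(1) by blast
  moreover have "x \<in> cyl (map x [0..<D])" by (simp add: cyl_def)
  ultimately have "(map x [0..<D], b) \<in> transitions f D"
    using assms(2) unfolding transitions_def by auto
  then show ?thesis by (rule rev_bexI[rotated]) simp
qed

theorem theorem2p5:
  shows "(\<forall>f\<in>cantor_maps. \<forall>\<epsilon>::real. \<epsilon> > 0 \<longrightarrow>
           (\<exists>K S M :: nat. K > 0 \<and> S > 0 \<and> M > 0 \<and>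
             (\<forall>k s m :: nat. k \<ge> K \<and> s \<ge> S \<and> m > 0 \<and> M dvd m \<longrightarrow>
               (\<exists>g\<in>cantor_maps. \<exists>P. clopen_partition P \<and>
                 unif_dist f g < \<epsilon> \<and> mesh P < \<epsilon> \<and>
                 consists_of_disjoint k (balloon s m) (Gr g P)))))
       \<and> (\<forall>f\<in>cantor_homeos. \<forall>\<epsilon>::real. \<epsilon> > 0 \<longrightarrow>
           (\<exists>K N S M :: nat. K > 0 \<and> N > 0 \<and> S > 0 \<and> M > 0 \<and>
             (\<forall>k n s m :: nat. k \<ge> K \<and> s \<ge> S \<and> n > 0 \<and> N dvd n \<and> m > 0 \<and> M dvd m \<longrightarrow>
               (\<exists>g\<in>cantor_homeos. \<exists>P. clopen_partition P \<and>
                 unif_dist f g < \<epsilon> \<and> mesh P < \<epsilon> \<and>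
                 consists_of_disjoint k (dumbbell n s m) (Gr g P)))))"
proof (intro conjI ballI allI impI)
  fix f :: "cantor \<Rightarrow> cantor" and \<epsilon> :: real
  assume f: "f \<in> cantor_maps" and "\<epsilon> > 0"
  obtain D where D: "resolves f \<epsilon> D" using resolves_exists[OF f \<open>\<epsilon> > 0\<close>] by blast
  define A where "A = {w :: bool list. length w = D}"
  have A: "finite A" using finite_lists_length_eq[of "UNIV :: bool set" D] by (simp add: A_def)
  have "\<exists>g\<in>cantor_maps. \<exists>P. clopen_partition P \<and> unif_dist f g < \<epsilon> \<and> mesh P < \<epsilon> \<and>
      consists_of_disjoint k (balloon s m) (Gr g P)"
    if "k \<ge> Suc (card A)" "s \<ge> Suc (card A)" "m > 0" "fact (card A) dvd m" for k s m
  proof -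
    have card_le: "card {w :: bool list. length w = D} \<le> k" using that(1) by (simp add: A_def)
    have E: "balloon_edges s m \<subseteq> {1..s + m} \<times> {1..s + m}"
      using that by (auto simp: balloon_edges_def path_edges_def)
    have out: "\<forall>p\<in>{1..s + m}. \<exists>q. (p, q) \<in> balloon_edges s m"
    proof
      fix p assume "p \<in> {1..s + m}"
      then show "\<exists>q. (p, q) \<in> balloon_edges s m"
        by (cases "p = s + m") (auto simp: balloon_edges_def path_edges_def)
    qed
    have "\<exists>\<zeta>. a \<in> \<zeta> ` {1..s + m} \<and> (\<forall>(p, q)\<in>balloon_edges s m. (\<zeta> p, \<zeta> q) \<in> transitions f D)"
      if "length a = D" for a
      by (rule balloon_walk[OF A]) (use that transitions_succ \<open>s \<ge> _\<close> \<open>fact _ dvd m\<close> in \<open>auto simp: A_def\<close>)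
    from approximate_by_copies[OF D card_le finite_atLeastAtMost E out this]
    obtain g P where "g \<in> cantor_maps" "clopen_partition P" "unif_dist f g < \<epsilon>" "mesh P < \<epsilon>"
      "copies k {1..s + m} (balloon_edges s m) (Gr g P)"
      by blast
    moreover from this have "consists_of_disjoint k (balloon s m) (Gr g P)"
      using that by (intro copies_consists_of_disjoint[OF _ E] balloon_copy) auto
    ultimately show ?thesis by blast
  qed
  then show "\<exists>K S M :: nat. K > 0 \<and> S > 0 \<and> M > 0 \<and>
      (\<forall>k s m :: nat. k \<ge> K \<and> s \<ge> S \<and> m > 0 \<and> M dvd m \<longrightarrow>
        (\<exists>g\<in>cantor_maps. \<exists>P. clopen_partition P \<and> unif_dist f g < \<epsilon> \<and> mesh P < \<epsilon> \<and>
          consists_of_disjoint k (balloon s m) (Gr g P)))"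
    by (intro exI[of _ "Suc (card A)"] exI[of _ "fact (card A)"]) simp
next
  fix f :: "cantor \<Rightarrow> cantor" and \<epsilon> :: real
  assume f: "f \<in> cantor_homeos" and "\<epsilon> > 0"
  then have maps: "f \<in> cantor_maps" and surj: "surj f"
    unfolding cantor_homeos_def cantor_maps_def homeomorphism_def by auto
  obtain D where D: "resolves f \<epsilon> D" using resolves_exists[OF maps \<open>\<epsilon> > 0\<close>] by blast
  define A where "A = {w :: bool list. length w = D}"
  have A: "finite A" using finite_lists_length_eq[of "UNIV :: bool set" D] by (simp add: A_def)
  have "\<exists>g\<in>cantor_homeos. \<exists>P. clopen_partition P \<and> unif_dist f g < \<epsilon> \<and> mesh P < \<epsilon> \<and>
      consists_of_disjoint k (dumbbell n s m) (Gr g P)"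
    if "k \<ge> Suc (card A)" "s \<ge> Suc (2 * card A)" "n > 0" "fact (card A) dvd n"
      "m > 0" "fact (card A) dvd m" for k n s m
  proof -
    have card_le: "card {w :: bool list. length w = D} \<le> k" using that(1) by (simp add: A_def)
    have E: "dumbbell_edges n s m \<subseteq> {1..n + s + m} \<times> {1..n + s + m}"
      using that by (auto simp: dumbbell_edges_def path_edges_def)
    have out: "\<forall>p\<in>{1..n + s + m}. \<exists>q. (p, q) \<in> dumbbell_edges n s m"
    proof
      fix p assume "p \<in> {1..n + s + m}"
      then show "\<exists>q. (p, q) \<in> dumbbell_edges n s m"
        by (cases "p = n + s + m") (auto simp: dumbbell_edges_def path_edges_def)
    qed
    have into: "\<exists>p. (p, q) \<in> dumbbell_edges n s m" if "q \<in> {1..n + s + m}" for q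
    proof (cases q)
      case (Suc p)
      then show ?thesis using that by (cases p) (auto simp: dumbbell_edges_def path_edges_def)
    qed (use that in simp)
    have "\<exists>\<zeta>. a \<in> \<zeta> ` {1..n + s + m} \<and> (\<forall>(p, q)\<in>dumbbell_edges n s m. (\<zeta> p, \<zeta> q) \<in> transitions f D)"
      if "length a = D" for a
      by (rule dumbbell_walk[OF A])
        (use that transitions_succ transitions_pred[OF surj] \<open>s \<ge> _\<close> \<open>n > 0\<close> \<open>fact _ dvd n\<close> \<open>fact _ dvd m\<close>
          in \<open>auto simp: A_def\<close>)
    \<comment> \<open>Every vertex of a dumbbell has an incoming edge, which is what makes \<open>g\<close> a homeomorphism.\<close>
    from approximate_by_copies[OF D card_le finite_atLeastAtMost E out this]
    obtain g P where "g \<in> cantor_homeos" "clopen_partition P" "unif_dist f g < \<epsilon>" "mesh P < \<epsilon>"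
      "copies k {1..n + s + m} (dumbbell_edges n s m) (Gr g P)"
      using into by blast
    moreover from this have "consists_of_disjoint k (dumbbell n s m) (Gr g P)"
      using that by (intro copies_consists_of_disjoint[OF _ E] dumbbell_copy) auto
    ultimately show ?thesis by blast
  qed
  then show "\<exists>K N S M :: nat. K > 0 \<and> N > 0 \<and> S > 0 \<and> M > 0 \<and>
      (\<forall>k n s m :: nat. k \<ge> K \<and> s \<ge> S \<and> n > 0 \<and> N dvd n \<and> m > 0 \<and> M dvd m \<longrightarrow>
        (\<exists>g\<in>cantor_homeos. \<exists>P. clopen_partition P \<and> unif_dist f g < \<epsilon> \<and> mesh P < \<epsilon> \<and>
          consists_of_disjoint k (dumbbell n s m) (Gr g P)))"
    by (intro exI[of _ "Suc (card A)"] exI[of _ "fact (card A)"] exI[of _ "Suc (2 * card A)"]) simp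
qed

end
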